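(* Let $(U,R)$ be an approximation space, let $X\subseteq U$ be a rough set in $(U,R)$, and let $\mu:U\to[0,1]$ be a given membership function on $U$. If $\mu_{R_1},\mu_{R_2}:U\times U\to[0,1]$ are two FR relations on $X$ (with respect to $\mu$), then the algebraic product $\mu_{R_1}\cdot\mu_{R_2}$, defined by $(\mu_{R_1}\cdot\mu_{R_2})(x,y)=\mu_{R_1}(x,y)\,\mu_{R_2}(x,y)$ for all $(x,y)\in U\times U$, is an FR relation on $X$ (with respect to $\mu$).
   Context: An approximation space $(U,R)$ is a set $U$ with an equivalence relation $R$ on $U$; $[x]_R$ is the $R$-class of $x$. Let $S$ be the equivalence relation on $U\times U$ given by $((x_1,y_1),(x_2,y_2))\in S$ iff $(x_1,x_2)\in R$ and $(y_1,y_2)\in R$; its classes are $[x,y]_S=[x]_R\times[y]_R$. A subset $X\subseteq U$ is a rough set if its lower approximation $\underline{X}=\{x\in U:[x]_R\subseteq X\}$ and its upper approximation $\overline{X}=\{x\in U:[x]_R\cap X\neq\emptyset\}$ are different. Put $\underline{X\times X}=\{(x,y)\in U\times U:[x,y]_S\subseteq X\times X\}$ and $\overline{X\times X}=\{(x,y)\in U\times U:[x,y]_S\cap (X\times X)\neq\emptyset\}$. Given a membership function $\mu:U\to[0,1]$ (a fuzzy set in $U$), a fuzzy rough relation (FR relation) on $X$ with respect to $\mu$ is a function $\mu_{R_1}:U\times U\to[0,1]$ such that $\mu_{R_1}(x,y)\le\min\{\mu(x),\mu(y)\}$ for all $(x,y)\in U\times U$ and (i) $\mu_{R_1}(x,y)=1$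 for all $(x,y)\in\underline{X\times X}$; (ii) $\mu_{R_1}(x,y)=0$ for all $(x,y)\in (U\times U)\setminus\overline{X\times X}$; (iii) $0<\mu_{R_1}(x,y)<1$ for all $(x,y)\in\overline{X\times X}\setminus\underline{X\times X}$. *)

theory Defs
  imports Complex_Main "HOL-Library.FuncSet"
begin

text \<open>
  An approximation space is a carrier set \<open>U\<close> with \<open>equiv U R\<close>; the class of \<open>x\<close> is
  \<open>R `` {x}\<close>. Functions on \<open>U\<close> or \<open>U \<times> U\<close> are total HOL functions of which only the
  values on that carrier matter.
\<close>

definition lower_approx :: "'a set \<Rightarrow> ('a \<times> 'a) set \<Rightarrow> 'a set \<Rightarrow> 'a set" where
  "lower_approx U R X = {x \<in> U. R `` {x} \<subseteq> X}"

definition upper_approx :: "'a set \<Rightarrow> ('a \<times> 'a) set \<Rightarrow> 'a set \<Rightarrow> 'a set" where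
  "upper_approx U R X = {x \<in> U. R `` {x} \<inter> X \<noteq> {}}"

definition rough_set :: "'a set \<Rightarrow> ('a \<times> 'a) set \<Rightarrow> 'a set \<Rightarrow> bool" where
  "rough_set U R X \<longleftrightarrow> X \<subseteq> U \<and> lower_approx U R X \<noteq> upper_approx U R X"

definition pair_rel :: "('a \<times> 'a) set \<Rightarrow> (('a \<times> 'a) \<times> ('a \<times> 'a)) set" where
  "pair_rel R = {((x1, y1), (x2, y2)) | x1 y1 x2 y2. (x1, x2) \<in> R \<and> (y1, y2) \<in> R}"

lemma equiv_pair_rel: "equiv U R \<Longrightarrow> equiv (U \<times> U) (pair_rel R)"
proof -
  assume "equiv U R"
  then have sub: "R \<subseteq> U \<times> U" and re: "refl_on U R" and sy: "sym R" and tr: "trans R"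
    by (auto elim: equivE)
  show ?thesis
  proof (rule equivI)
    show "pair_rel R \<subseteq> (U \<times> U) \<times> (U \<times> U)"
      using sub by (auto simp: pair_rel_def)
    show "refl_on (U \<times> U) (pair_rel R)"
      using re by (auto simp: pair_rel_def refl_on_def)
    show "sym (pair_rel R)"
      using sy by (auto simp: pair_rel_def intro!: symI dest: symD)
    show "trans (pair_rel R)"
      using tr by (auto simp: pair_rel_def intro!: transI dest: transD)
  qed
qed

lemma pair_rel_class: "pair_rel R `` {(x, y)} = R `` {x} \<times> R `` {y}"
  unfolding pair_rel_def by blast

definition FR_relation ::
  "'a set \<Rightarrow> ('a \<times> 'a) set \<Rightarrow> 'a set \<Rightarrow> ('a \<Rightarrow> real) \<Rightarrow> ('a \<times> 'a \<Rightarrow> real) \<Rightarrow> bool" where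
  "FR_relation U R X \<mu> \<rho> \<longleftrightarrow>
     \<rho> \<in> U \<times> U \<rightarrow> {0..1} \<and>
     (\<forall>x\<in>U. \<forall>y\<in>U. \<rho> (x, y) \<le> min (\<mu> x) (\<mu> y)) \<and>
     (\<forall>p \<in> lower_approx (U \<times> U) (pair_rel R) (X \<times> X). \<rho> p = 1) \<and>
     (\<forall>p \<in> (U \<times> U) - upper_approx (U \<times> U) (pair_rel R) (X \<times> X). \<rho> p = 0) \<and>
     (\<forall>p \<in> upper_approx (U \<times> U) (pair_rel R) (X \<times> X)
            - lower_approx (U \<times> U) (pair_rel R) (X \<times> X). 0 < \<rho> p \<and> \<rho> p < 1)"

end

theory Submission
  imports Defs
begin

text \<open>Multiplying a number in [0,1] by another one cannot increase it, so on
  \<open>U \<times> U\<close> the product is dominated by \<open>\<mu>1\<close>. It therefore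
  inherits from \<open>\<mu>1\<close> the bound by \<open>min (\<mu> x) (\<mu> y)\<close> and, on
  the boundary region, the strict bound below 1. The remaining conditions are closure properties of
  multiplication: 1 times 1 is 1, 0 absorbs, and positive factors have a positive product.\<close>

theorem proposition3p4:
  fixes U X :: "'a set"
    and R :: "('a \<times> 'a) set"
    and \<mu> :: "'a \<Rightarrow> real"
    and \<mu>1 \<mu>2 :: "'a \<times> 'a \<Rightarrow> real"
  assumes "equiv U R"
    and "rough_set U R X"
    and "\<mu> \<in> U \<rightarrow> {0..1}"
    and "FR_relation U R X \<mu> \<mu>1"
    and "FR_relation U R X \<mu> \<mu>2"
  shows "FR_relation U R X \<mu> (\<lambda>(x, y). \<mu>1 (x, y) * \<mu>2 (x, y))"
proof -
  \<comment> \<open>The functions are total in HOL, so these bounds hold only for arguments in the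
    carrier \<open>U\<close>.\<close>
  have r1: "0 \<le> \<mu>1 (x, y)" "\<mu>1 (x, y) \<le> 1" "\<mu>1 (x, y) \<le> min (\<mu> x) (\<mu> y)"
    and r2: "0 \<le> \<mu>2 (x, y)" "\<mu>2 (x, y) \<le> 1"
    if "x \<in> U" "y \<in> U" for x y
    using assms(4,5) that unfolding FR_relation_def by (auto simp: Pi_iff)
  \<comment> \<open>Uses \<open>\<mu>2 \<le> 1\<close> and \<open>0 \<le> \<mu>1\<close>. This
    domination serves the range, the \<open>min\<close> bound and the strict upper bound.\<close>
  have le: "\<mu>1 (x, y) * \<mu>2 (x, y) \<le> \<mu>1 (x, y)" if "x \<in> U" "y \<in> U" for x y
    using r1[OF that] r2[OF that] by (simp add: mult_left_le)
  show ?thesis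
    unfolding FR_relation_def
  proof (intro conjI ballI)
    show "(\<lambda>(x, y). \<mu>1 (x, y) * \<mu>2 (x, y)) \<in> U \<times> U \<rightarrow> {0..1}"
      using r1 r2 by (force intro!: mult_nonneg_nonneg order_trans[OF le])
  next
    fix x y assume "x \<in> U" "y \<in> U"
    then show "(case (x, y) of (x, y) \<Rightarrow> \<mu>1 (x, y) * \<mu>2 (x, y)) \<le> min (\<mu> x) (\<mu> y)"
      using le r1(3) by (metis case_prod_conv order_trans)
  next
    fix p assume "p \<in> lower_approx (U \<times> U) (pair_rel R) (X \<times> X)"
    then have "\<mu>1 p = 1" "\<mu>2 p = 1"
      using assms(4,5) unfolding FR_relation_def by blast+
    then show "(case p of (x, y) \<Rightarrow> \<mu>1 (x, y) * \<mu>2 (x, y)) = 1"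
      by (simp add: split_beta)
  next
    fix p assume "p \<in> (U \<times> U) - upper_approx (U \<times> U) (pair_rel R) (X \<times> X)"
    then have "\<mu>1 p = 0"
      using assms(4) unfolding FR_relation_def by blast
    then show "(case p of (x, y) \<Rightarrow> \<mu>1 (x, y) * \<mu>2 (x, y)) = 0"
      by (simp add: split_beta)
  next
    fix p
    assume p: "p \<in> upper_approx (U \<times> U) (pair_rel R) (X \<times> X)
                   - lower_approx (U \<times> U) (pair_rel R) (X \<times> X)"
    have pos: "0 < \<mu>1 p" "\<mu>1 p < 1" "0 < \<mu>2 p"
      using assms(4,5) p unfolding FR_relation_def by blast+
    then show "0 < (case p of (x, y) \<Rightarrow> \<mu>1 (x, y) * \<mu>2 (x, y))"
      by (simp add: split_beta)
    \<comment> \<open>An upper approximation lies in its carrier by definition, so \<open>p\<close>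
      splits into coordinates in \<open>U\<close> and \<open>le\<close> applies: the product is at
      most \<open>\<mu>1 p\<close>, which is below 1.\<close>
    obtain x y where "p = (x, y)" "x \<in> U" "y \<in> U"
      using p by (auto simp: upper_approx_def)
    then show "(case p of (x, y) \<Rightarrow> \<mu>1 (x, y) * \<mu>2 (x, y)) < 1"
      using pos(2) le by fastforce
  qed
qed

end
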